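(* Let $d$ be a positive integer and let $x_1\le x_2\le\ldots$ be a monotone increasing infinite sequence of positive numbers. The sequence $x_1,x_2,\ldots$ is $\mathcal{P}_d$-controlling if and only if $$\sum_{i=1}^{\infty}\frac1{x_i^d}=\infty.$$
   Context: $\mathcal{P}_d$ denotes the class of polynomials in one variable with real coefficients of degree at most $d$. A sequence of positive numbers $x_1,x_2,\ldots$ is $\mathcal{P}_d$-controlling if there exist reals $y_1,y_2,\ldots$ such that for every polynomial $p\in\mathcal{P}_d$ there is an index $i$ with $|p(x_i)-y_i|\le 1$. "Monotone increasing" is meant in the non-strict sense. *)

theory Defs
  imports "HOL-Analysis.Analysis" "HOL-Computational_Algebra.Polynomial"
begin

definition polys_upto :: "nat \<Rightarrow> real poly set" where
  "polys_upto d = {p. degree p \<le> d}"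

(* Sequences are indexed from 0, so x 0 is the first term. Positivity of the terms is
   not part of the predicate; it has to be assumed where the predicate is used. *)
definition poly_controlling :: "nat \<Rightarrow> (nat \<Rightarrow> real) \<Rightarrow> bool" where
  "poly_controlling d x \<longleftrightarrow>
     (\<exists>y :: nat \<Rightarrow> real. \<forall>p \<in> polys_upto d. \<exists>i. \<bar>poly p (x i) - y i\<bar> \<le> 1)"

end

theory Submission
  imports Defs
begin

text \<open>
  Necessity already fails on the monomials \<open>a x^d\<close>: each index controls an interval of
  length \<open>2 / x i ^ d\<close> of values \<open>a\<close>, and countably many intervals of finite total length
  do not cover the line. For sufficiency, put \<open>u i = 1 / x i\<close> and divide by \<open>x i ^ d\<close>: a polynomial
  \<open>p\<close> becomes \<open>q (u i)\<close> for a polynomial \<open>q\<close>, to be approximated within \<open>\<delta> i = 1 / x i ^ d\<close>. Among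
  the \<open>q\<close> that are bounded by \<open>A\<close> and \<open>A\<close>-Lipschitz on \<open>[0, u 0]\<close>, sweep the values upwards
  from \<open>-A\<close>: at each index the swept level rises by \<open>2 \<delta> i\<close>, minus a loss \<open>A (u i - u (i + 1))\<close>
  that accounts for the change of \<open>q\<close>. The losses telescope and stay below \<open>A u 0\<close>, so
  the level exceeds \<open>A\<close> after finitely many steps. Then continue with a larger \<open>A\<close>.
\<close>

lemma filterlim_sum_at_top_or_summable:
  fixes g :: "nat \<Rightarrow> real"
  assumes "\<And>i. g i \<ge> 0"
  shows "filterlim (\<lambda>n. \<Sum>i<n. g i) at_top sequentially \<or> summable g"
proof (rule disjCI)
  assume ns: "\<not> summable g"
  show "filterlim (\<lambda>n. \<Sum>i<n. g i) at_top sequentially"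
    unfolding filterlim_at_top
  proof
    fix Z :: real
    obtain n where n: "(\<Sum>i<n. g i) > Z"
      using summableI_nonneg_bounded[of g Z] assms ns by (meson not_le)
    have "Z \<le> (\<Sum>i<m. g i)" if "m \<ge> n" for m
      using n sum_mono2[of "{..<m}" "{..<n}" g] that assms by auto
    then show "\<forall>\<^sub>F m in sequentially. Z \<le> (\<Sum>i<m. g i)"
      by (auto simp: eventually_sequentially)
  qed
qed

text \<open>Countable subadditivity bounds the measure of the union by the finite sum of the
  lengths, whereas the line has infinite measure.\<close>

lemma reals_not_covered_by_intervals_of_finite_length:
  fixes c r :: "nat \<Rightarrow> real"
  assumes r: "\<And>i. r i \<ge> 0" and "summable r"
  shows "\<exists>a. \<forall>i. \<bar>a - c i\<bar> > r i"
proof (rule ccontr)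
  assume "\<not> ?thesis"
  then have cover: "(\<Union>i. {c i - r i .. c i + r i}) = UNIV"
    by (fastforce simp: not_less abs_le_iff algebra_simps)
  have "\<infinity> = emeasure lborel (\<Union>i. {c i - r i .. c i + r i})"
    by (simp add: cover)
  also have "\<dots> \<le> (\<Sum>i. emeasure lborel {c i - r i .. c i + r i})"
    by (rule emeasure_subadditive_countably) auto
  also have "\<dots> = (\<Sum>i. ennreal (2 * r i))"
    using r by (intro suminf_cong) simp
  also have "\<dots> = ennreal (\<Sum>i. 2 * r i)"
    using assms by (intro suminf_ennreal2) (auto intro: summable_mult)
  also have "\<dots> < \<infinity>" by simp
  finally show False by simp
qed

text \<open>The window at \<open>i\<close> reaches from \<open>L i\<close> to
  \<open>L i + 2 * \<delta> i\<close>. A value above it cannot fall below \<open>L (Suc i)\<close>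
  in one step, so a sequence that gets from above \<open>L\<close> to below it must hit a window on
  the way.\<close>

lemma sweep:
  fixes f \<delta> u L :: "nat \<Rightarrow> real"
  assumes start: "f N \<ge> L N"
    and step: "\<And>i. i \<ge> N \<Longrightarrow> L (Suc i) + A * (u i - u (Suc i)) \<le> L i + 2 * \<delta> i"
    and var: "\<And>i. \<bar>f i - f (Suc i)\<bar> \<le> A * (u i - u (Suc i))"
    and "n \<ge> N" and "f n < L n"
  shows "\<exists>i\<in>{N..<n}. \<bar>f i - (L i + \<delta> i)\<bar> \<le> \<delta> i"
  using assms(4,5)
proof (induction n rule: dec_induct)
  case base
  then show ?case using start by simp
next
  case (step n)
  \<comment> \<open>Read backwards: being below \<open>L\<close> at \<open>Suc n\<close> forces
    \<open>f n\<close> below the top of the window at \<open>n\<close>.\<close>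
  have "f n < L n + 2 * \<delta> n"
    using var[of n] assms(2)[of n] step by linarith
  then show ?case
  proof (cases "f n < L n")
    case True
    then show ?thesis using step.IH by force
  next
    case False
    then have "\<bar>f n - (L n + \<delta> n)\<bar> \<le> \<delta> n"
      using \<open>f n < L n + 2 * \<delta> n\<close> by (simp add: abs_le_iff)
    then show ?thesis using step.hyps by auto
  qed
qed

text \<open>For fixed \<open>A\<close>, finitely many indices from \<open>N\<close> on suffice, with
  centres \<open>z\<close> that do not depend on \<open>f\<close>. The indices from \<open>M\<close>
  on stay free for larger bounds.\<close>

lemma sweep_block:
  fixes \<delta> u :: "nat \<Rightarrow> real" and A :: real
  assumes u: "\<And>i. u i \<ge> 0" and A: "A \<ge> 0"
    and div: "filterlim (\<lambda>n. \<Sum>i<n. \<delta> i) at_top sequentially"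
  shows "\<exists>M z. N < M \<and> (\<forall>f. (\<forall>i. \<bar>f i\<bar> \<le> A) \<longrightarrow>
           (\<forall>i. \<bar>f i - f (Suc i)\<bar> \<le> A * (u i - u (Suc i))) \<longrightarrow>
           (\<exists>i\<in>{N..<M}. \<bar>f i - z i\<bar> \<le> \<delta> i))"
proof -
  \<comment> \<open>The solution with equality of the recursion in \<open>sweep\<close>, started at
    the lower bound \<open>-A\<close> of \<open>f N\<close>.\<close>
  define L where "L n = - A + 2 * (\<Sum>i\<in>{N..<n}. \<delta> i) - A * (u N - u n)" for n
  \<comment> \<open>Twice the sum from \<open>N\<close> on must exceed the climb
    \<open>2 * A\<close> plus the total loss, at most \<open>A * u N\<close>; the extra 1 makes this
    strict.\<close>
  have "\<forall>\<^sub>F n in sequentially. (\<Sum>i<n. \<delta> i) \<ge> (\<Sum>i<N. \<delta> i) + 1 + A + A * u N / 2"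
    using div unfolding filterlim_at_top by blast
  then obtain M where M: "M > N" "(\<Sum>i<M. \<delta> i) \<ge> (\<Sum>i<N. \<delta> i) + 1 + A + A * u N / 2"
    unfolding eventually_sequentially by (meson le_SucI less_Suc_eq_le nat_le_linear)
  have "(\<Sum>i<M. \<delta> i) = (\<Sum>i<N. \<delta> i) + (\<Sum>i\<in>{N..<M}. \<delta> i)"
    using M(1) by (simp add: lessThan_atLeast0 sum.atLeastLessThan_concat)
  moreover have "A * (u N - u M) \<le> A * u N"
    using A u[of M] by (intro mult_left_mono) auto
  ultimately have LM: "L M > A"
    using M(2) unfolding L_def by argo
  have "\<exists>i\<in>{N..<M}. \<bar>f i - (L i + \<delta> i)\<bar> \<le> \<delta> i"
    if "\<forall>i. \<bar>f i\<bar> \<le> A" "\<forall>i. \<bar>f i - f (Suc i)\<bar> \<le> A * (u i - u (Suc i))" for f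
  proof (rule sweep[where u = u and A = A])
    show "L N \<le> f N"
      using that(1)[rule_format, of N] by (simp add: L_def abs_le_iff)
    show "f M < L M"
      using that(1)[rule_format, of M] LM by linarith
    show "L (Suc i) + A * (u i - u (Suc i)) \<le> L i + 2 * \<delta> i" if "i \<ge> N" for i
      using that by (simp add: L_def algebra_simps)
  qed (use that M in auto)
  then show ?thesis using M(1) by (intro exI[of _ M] exI[of _ "\<lambda>i. L i + \<delta> i"]) auto
qed

text \<open>Consecutive blocks of indices serve the bounds 0, 1, 2, and so on; a sequence with bound
  \<open>A\<close> is caught in every block whose number is at least \<open>A\<close>.\<close>

lemma sweep_all:
  fixes \<delta> u :: "nat \<Rightarrow> real"
  assumes u: "\<And>i. u i \<ge> 0" and "decseq u"
    and div: "filterlim (\<lambda>n. \<Sum>i<n. \<delta> i) at_top sequentially"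
  shows "\<exists>z. \<forall>f A. (\<forall>i. \<bar>f i\<bar> \<le> A) \<longrightarrow>
           (\<forall>i. \<bar>f i - f (Suc i)\<bar> \<le> A * (u i - u (Suc i))) \<longrightarrow>
           (\<exists>i. \<bar>f i - z i\<bar> \<le> \<delta> i)"
proof -
  have "\<exists>M z. N < M \<and> (\<forall>f. (\<forall>i. \<bar>f i\<bar> \<le> real k) \<longrightarrow>
           (\<forall>i. \<bar>f i - f (Suc i)\<bar> \<le> real k * (u i - u (Suc i))) \<longrightarrow>
           (\<exists>i\<in>{N..<M}. \<bar>f i - z i\<bar> \<le> \<delta> i))" for N k
    using u div by (intro sweep_block) simp_all
  then obtain M z where M: "\<And>N k. N < M N k"
    and z: "\<And>N k f. \<lbrakk>\<And>i. \<bar>f i\<bar> \<le> real k;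
           \<And>i. \<bar>f i - f (Suc i)\<bar> \<le> real k * (u i - u (Suc i))\<rbrakk> \<Longrightarrow>
           \<exists>i\<in>{N..<M N k}. \<bar>f i - z N k i\<bar> \<le> \<delta> i"
    by metis
  define b where "b = rec_nat 0 (\<lambda>k N. M N k)"
  have b_Suc: "b (Suc k) = M (b k) k" for k by (simp add: b_def)
  have "strict_mono b"
    using M by (simp add: strict_mono_Suc_iff b_Suc)
  \<comment> \<open>The number of the block containing \<open>i\<close>; it glues the centres of the
    separate blocks into one sequence.\<close>
  define blk where "blk i = (LEAST k. i < b (Suc k))" for i
  have blk: "blk i = k" if "i \<in> {b k..<b (Suc k)}" for i k
    unfolding blk_def
  proof (rule Least_equality)
    fix j assume "i < b (Suc j)"
    then have "b k < b (Suc j)" using that by simp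
    then show "k \<le> j" using \<open>strict_mono b\<close> by (simp add: strict_mono_less)
  qed (use that in simp)
  show ?thesis
  proof (intro exI[of _ "\<lambda>i. z (b (blk i)) (blk i) i"] allI impI)
    fix f A
    assume bd: "\<forall>i. \<bar>f i\<bar> \<le> A"
      and var: "\<forall>i. \<bar>f i - f (Suc i)\<bar> \<le> A * (u i - u (Suc i))"
    obtain k :: nat where k: "A \<le> real k" using real_arch_simple by blast
    have "\<exists>i\<in>{b k..<M (b k) k}. \<bar>f i - z (b k) k i\<bar> \<le> \<delta> i"
    proof (rule z)
      show "\<bar>f i\<bar> \<le> real k" for i using bd k by (meson order_trans)
      have "A * (u i - u (Suc i)) \<le> real k * (u i - u (Suc i))" for i
        using k decseq_SucD[OF \<open>decseq u\<close>, of i] by (intro mult_right_mono) auto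
      then show "\<bar>f i - f (Suc i)\<bar> \<le> real k * (u i - u (Suc i))" for i
        using var by (meson order_trans)
    qed
    then show "\<exists>i. \<bar>f i - z (b (blk i)) (blk i) i\<bar> \<le> \<delta> i"
      using blk b_Suc by metis
  qed
qed

text \<open>Compactness bounds \<open>q\<close> and its derivative, and the mean value inequality
  applies. The maximum of both bounds serves as the single \<open>A\<close> of
  \<open>sweep_all\<close>.\<close>

lemma poly_bounded_Lipschitz_on_interval:
  fixes q :: "real poly"
  shows "\<exists>A. (\<forall>s\<in>{0..U}. \<bar>poly q s\<bar> \<le> A) \<and>
             (\<forall>s\<in>{0..U}. \<forall>t\<in>{0..U}. \<bar>poly q s - poly q t\<bar> \<le> A * \<bar>s - t\<bar>)"
proof -
  have "\<exists>B. \<forall>s\<in>{0..U}. \<bar>poly r s\<bar> \<le> B" for r :: "real poly"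
  proof -
    have "compact (poly r ` {0..U})"
      by (intro compact_continuous_image continuous_intros) auto
    then show ?thesis
      by (auto dest!: compact_imp_bounded simp: bounded_iff)
  qed
  then obtain B C where B: "\<forall>s\<in>{0..U}. \<bar>poly q s\<bar> \<le> B"
    and C: "\<forall>s\<in>{0..U}. \<bar>poly (pderiv q) s\<bar> \<le> C" by meson
  have "\<bar>poly q s - poly q t\<bar> \<le> C * \<bar>s - t\<bar>" if "s \<in> {0..U}" "t \<in> {0..U}" for s t
    using field_differentiable_bound[of "{0..U}" "poly q" "poly (pderiv q)" C s t] C that
    by (auto intro: has_field_derivative_at_within poly_DERIV)
  moreover have "C * \<bar>s - t\<bar> \<le> max B C * \<bar>s - t\<bar>" for s t
    by (intro mult_right_mono) auto
  ultimately show ?thesis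
    using B by (intro exI[of _ "max B C"]) (meson max.cobounded1 order_trans)
qed

lemma poly_div_power_eq_poly_inverse:
  fixes p :: "real poly"
  assumes "degree p \<le> d"
  shows "\<exists>q. \<forall>t. t \<noteq> 0 \<longrightarrow> poly p t / t ^ d = poly q (1 / t)"
\<comment> \<open>Reflection accounts for division by \<open>t ^ degree p\<close> only; the monomial
  supplies the missing powers of \<open>1 / t\<close>.\<close>
proof (intro exI[of _ "reflect_poly p * monom 1 (d - degree p)"] allI impI)
  fix t :: real assume "t \<noteq> 0"
  then have "poly (reflect_poly p * monom 1 (d - degree p)) (1 / t)
      = (1 / t) ^ (degree p + (d - degree p)) * poly p t"
    by (simp add: poly_reflect_poly_nz poly_monom power_add field_simps)
  then show "poly p t / t ^ d = poly (reflect_poly p * monom 1 (d - degree p)) (1 / t)"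
    using assms by (simp add: field_simps)
qed

theorem theorem3:
  fixes d :: nat and x :: "nat \<Rightarrow> real"
  assumes "d > 0"
    and "\<And>i. x i > 0"
    and "mono x"
  shows "poly_controlling d x \<longleftrightarrow>
    filterlim (\<lambda>n. \<Sum>i<n. 1 / x i ^ d) at_top sequentially"
proof
  assume "poly_controlling d x"
  then obtain y where y: "\<And>p. degree p \<le> d \<Longrightarrow> \<exists>i. \<bar>poly p (x i) - y i\<bar> \<le> 1"
    by (auto simp: poly_controlling_def polys_upto_def)
  have "\<not> summable (\<lambda>i. 1 / x i ^ d)"
  proof
    assume "summable (\<lambda>i. 1 / x i ^ d)"
    \<comment> \<open>After division by \<open>x i ^ d\<close>, index \<open>i\<close> controls
      \<open>a * t ^ d\<close> exactly when \<open>a\<close> is within \<open>1 / x i ^ d\<close> of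
      \<open>y i / x i ^ d\<close>; this \<open>a\<close> escapes every index.\<close>
    then obtain a where a: "\<And>i. \<bar>a - y i / x i ^ d\<bar> > 1 / x i ^ d"
      using reals_not_covered_by_intervals_of_finite_length
        [of "\<lambda>i. 1 / x i ^ d" "\<lambda>i. y i / x i ^ d"] assms(2)
      by (auto simp: less_imp_le)
    obtain i where i: "\<bar>a * x i ^ d - y i\<bar> \<le> 1"
      using y[of "monom a d"] degree_monom_le[of a d] by (auto simp: poly_monom)
    have pos: "x i ^ d > 0" using assms(2) by simp
    have "a - y i / x i ^ d = (a * x i ^ d - y i) / x i ^ d"
      using assms(2)[of i] by (simp add: diff_divide_distrib)
    then have "\<bar>a - y i / x i ^ d\<bar> = \<bar>a * x i ^ d - y i\<bar> / x i ^ d"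
      using pos by (simp only: abs_divide abs_of_pos)
    also have "\<dots> \<le> 1 / x i ^ d" using i pos by (intro divide_right_mono) auto
    finally show False using a[of i] by simp
  qed
  then show "filterlim (\<lambda>n. \<Sum>i<n. 1 / x i ^ d) at_top sequentially"
    using filterlim_sum_at_top_or_summable[of "\<lambda>i. 1 / x i ^ d"] assms(2)
    by (auto simp: less_imp_le)
next
  assume div: "filterlim (\<lambda>n. \<Sum>i<n. 1 / x i ^ d) at_top sequentially"
  define u where "u i = 1 / x i" for i
  \<comment> \<open>Monotonicity of \<open>x\<close> enters here: the steps
    \<open>u i - u (Suc i)\<close> are nonnegative, and all \<open>u i\<close> lie in one compact
    interval.\<close>
  have dec: "decseq u"
    unfolding decseq_def u_def
    using assms(2) monoD[OF assms(3)] by (auto intro!: divide_left_mono)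
  have u: "u i \<in> {0..u 0}" for i
    using assms(2)[of i] decseqD[OF dec, of 0 i] by (simp add: u_def)
  obtain z where z: "\<And>f A. \<lbrakk>\<And>i. \<bar>f i\<bar> \<le> A;
        \<And>i. \<bar>f i - f (Suc i)\<bar> \<le> A * (u i - u (Suc i))\<rbrakk> \<Longrightarrow> \<exists>i. \<bar>f i - z i\<bar> \<le> 1 / x i ^ d"
    using sweep_all[of u, OF _ dec div] u by (metis atLeastAtMost_iff)
  \<comment> \<open>Multiplying by \<open>x i ^ d\<close> undoes the division and turns the
    tolerance \<open>1 / x i ^ d\<close> into 1.\<close>
  have "\<exists>i. \<bar>poly p (x i) - z i * x i ^ d\<bar> \<le> 1" if deg: "degree p \<le> d" for p
  proof -
    obtain q where q: "\<And>t. t \<noteq> 0 \<Longrightarrow> poly p t / t ^ d = poly q (1 / t)"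
      using poly_div_power_eq_poly_inverse[OF deg] by blast
    obtain A where A: "\<And>s. s \<in> {0..u 0} \<Longrightarrow> \<bar>poly q s\<bar> \<le> A"
      "\<And>s t. \<lbrakk>s \<in> {0..u 0}; t \<in> {0..u 0}\<rbrakk> \<Longrightarrow> \<bar>poly q s - poly q t\<bar> \<le> A * \<bar>s - t\<bar>"
      using poly_bounded_Lipschitz_on_interval[of "u 0" q] by blast
    have "\<exists>i. \<bar>poly q (u i) - z i\<bar> \<le> 1 / x i ^ d"
    proof (rule z)
      show "\<bar>poly q (u i)\<bar> \<le> A" for i using A(1) u by blast
      show "\<bar>poly q (u i) - poly q (u (Suc i))\<bar> \<le> A * (u i - u (Suc i))" for i
        using A(2)[OF u[of i] u[of "Suc i"]] decseq_SucD[OF dec, of i] by simp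
    qed
    then obtain i where i: "\<bar>poly q (u i) - z i\<bar> \<le> 1 / x i ^ d" ..
    have pos: "x i ^ d > 0" using assms(2) by simp
    have "poly p (x i) = poly q (u i) * x i ^ d"
      using q[of "x i"] assms(2)[of i] by (simp add: u_def field_simps)
    then have "\<bar>poly p (x i) - z i * x i ^ d\<bar> = \<bar>poly q (u i) - z i\<bar> * x i ^ d"
      using pos by (simp add: abs_mult flip: left_diff_distrib)
    also have "\<dots> \<le> 1" using i pos by (simp add: pos_le_divide_eq)
    finally show ?thesis by blast
  qed
  then show "poly_controlling d x"
    unfolding poly_controlling_def polys_upto_def by (intro exI[of _ "\<lambda>i. z i * x i ^ d"]) auto
qed

end
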